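(* Let $\mathcal F$ be a finite set of flows, $\mathcal R$ a finite set of APs with $|\mathcal R|=R\ge 2$, costs $e_i^f>0$ and payments $C^f>0$ ($i\in\mathcal R$, $f\in\mathcal F$). Let $\hat{\mathbf r}=(\hat r_i^f)_{i\in\mathcal R,f\in\mathcal F}$ be any Nash equilibrium of the followers' game without capacity limit, and let $\hat{\mathcal S}_f=\{i\in\mathcal R:\hat r_i^f>0\}$. Then for every $f\in\mathcal F$: 1. $\hat r_i^f=\dfrac{(|\hat{\mathcal S}_f|-1)C^f}{\sum_{j\in\hat{\mathcal S}_f}e_j^f}\left(1-\dfrac{(|\hat{\mathcal S}_f|-1)e_i^f}{\sum_{j\in\hat{\mathcal S}_f}e_j^f}\right)$ if $i\in\hat{\mathcal S}_f$, and $\hat r_i^f=0$ otherwise. 2. If $\sigma_1,\dots,\sigma_R$ is a permutation of $\mathcal R$ with $e^f_{\sigma_1}\le e^f_{\sigma_2}\le\cdots\le e^f_{\sigma_R}$, then $\hat{\mathcal S}_f=\{\sigma_1,\dots,\sigma_i\}$ for some $i\ge 2$ such that (when $i<R$) $e^f_{\sigma_{i+1}}\ge\dfrac{\sum_{j=1}^i e^f_{\sigma_j}}{i-1}$. Consequently, the followers' game without capacity limit has a unique Nash equilibrium.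
   Context: Followers' game without capacity limit: the players are the APs $i\in\mathcal R$; AP $i$ chooses $\mathbf r_i=(r_i^f)_{f\in\mathcal F}\in[0,\infty)^{\mathcal F}$ and its payoff is $$V_i=\sum_{f\in\mathcal F}\left[C^f\frac{r_i^f}{\sum_{j\in\mathcal R}r_j^f}-e_i^f r_i^f\right],$$ with the fraction read as $0$ when $r_j^f=0$ for all $j\in\mathcal R$. *)

theory Defs
  imports Complex_Main "HOL-Library.FuncSet"
begin

text \<open>
  Strategic games with player set \<open>N\<close>, strategy sets \<open>S i\<close> and payoffs \<open>u i\<close>.  Profiles are
  extensional on \<open>N\<close>, so that two profiles are equal as soon as they agree on the players.
\<close>

definition nash_equilibrium ::
    "'p set \<Rightarrow> ('p \<Rightarrow> 's set) \<Rightarrow> ('p \<Rightarrow> ('p \<Rightarrow> 's) \<Rightarrow> real) \<Rightarrow> ('p \<Rightarrow> 's) \<Rightarrow> bool" where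
  "nash_equilibrium N S u r \<longleftrightarrow>
     r \<in> Pi\<^sub>E N S \<and> (\<forall>i\<in>N. \<forall>s\<in>S i. u i (r(i := s)) \<le> u i r)"

text \<open>
  In the followers' game the APs are indexed by \<open>R\<close> and the flows by \<open>F\<close>; \<open>r i f\<close> is the amount
  AP \<open>i\<close> chooses for flow \<open>f\<close>, \<open>e i f\<close> its unit cost, and \<open>C f\<close> the payment for flow \<open>f\<close>.
  A strategy is an element of \<open>[0,\<infinity>)\<^sup>F\<close>, again encoded as an extensional function.
\<close>

definition follower_strategies :: "'f set \<Rightarrow> ('f \<Rightarrow> real) set" where
  "follower_strategies F = (F \<rightarrow>\<^sub>E {0..})"

definition follower_share :: "'r set \<Rightarrow> ('r \<Rightarrow> 'f \<Rightarrow> real) \<Rightarrow> 'r \<Rightarrow> 'f \<Rightarrow> real" where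
  "follower_share R r i f =
     (if \<forall>j\<in>R. r j f = 0 then 0 else r i f / (\<Sum>j\<in>R. r j f))"

definition follower_payoff ::
    "'f set \<Rightarrow> 'r set \<Rightarrow> ('r \<Rightarrow> 'f \<Rightarrow> real) \<Rightarrow> ('f \<Rightarrow> real) \<Rightarrow> 'r \<Rightarrow> ('r \<Rightarrow> 'f \<Rightarrow> real) \<Rightarrow> real" where
  "follower_payoff F R e C i r = (\<Sum>f\<in>F. C f * follower_share R r i f - e i f * r i f)"

definition followers_equilibrium ::
    "'f set \<Rightarrow> 'r set \<Rightarrow> ('r \<Rightarrow> 'f \<Rightarrow> real) \<Rightarrow> ('f \<Rightarrow> real) \<Rightarrow> ('r \<Rightarrow> 'f \<Rightarrow> real) \<Rightarrow> bool" where
  "followers_equilibrium F R e C r \<longleftrightarrow>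
     nash_equilibrium R (\<lambda>_. follower_strategies F) (follower_payoff F R e C) r"

definition active_aps :: "'r set \<Rightarrow> ('r \<Rightarrow> 'f \<Rightarrow> real) \<Rightarrow> 'f \<Rightarrow> 'r set" where
  "active_aps R r f = {i \<in> R. r i f > 0}"

end

theory Submission imports Defs begin

text \<open>
  The payoff is additive over flows, so a profile is an equilibrium iff each of its flows is an
  equilibrium of a single contest with prize \<open>v\<close> and costs \<open>c\<close>.  In such a contest the first-order
  conditions determine all bids from their total \<open>T\<close>, namely \<open>x i = T * max 0 (1 - c i * T / v)\<close>.
  Summing gives \<open>(\<Sum>i. max 0 (1 - c i * T / v)) = 1\<close>, whose left side is continuous and strictly
  decreasing while positive, so that \<open>T\<close> exists and is unique.  Moreover \<open>i\<close> is active iff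
  \<open>c i < v / T\<close>, and summing over the active players only yields \<open>v / T = E / m\<close>.
\<close>

section \<open>Single-prize contest: best responses and first-order conditions\<close>

text \<open>Division by zero returns 0, which is the convention for the share when nobody
  bids.\<close>

definition contest_payoff :: "'r set \<Rightarrow> ('r \<Rightarrow> real) \<Rightarrow> real \<Rightarrow> 'r \<Rightarrow> ('r \<Rightarrow> real) \<Rightarrow> real" where
  "contest_payoff R c v i x = v * (x i / sum x R) - c i * x i"

definition contest_equilibrium :: "'r set \<Rightarrow> ('r \<Rightarrow> real) \<Rightarrow> real \<Rightarrow> ('r \<Rightarrow> real) \<Rightarrow> bool" where
  "contest_equilibrium R c v x \<longleftrightarrow>
     (\<forall>i\<in>R. 0 \<le> x i \<and> (\<forall>t\<ge>0. contest_payoff R c v i (x(i := t)) \<le> contest_payoff R c v i x))"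

lemma sum_fun_upd:
  fixes x :: "'a \<Rightarrow> 'b::ab_group_add"
  assumes "finite R" "i \<in> R"
  shows "sum (x(i := t)) R = sum x R - x i + t"
proof -
  have "sum (x(i := t)) (R - {i}) = sum x (R - {i})"
    by (rule sum.cong) auto
  then show ?thesis
    using assms by (simp add: sum.remove[of R i])
qed

text \<open>The first-order condition \<open>v * A / (A + x)\<^sup>2 \<le> c\<close>, with equality
  at an interior bid, where \<open>A\<close> is the total bid of the rivals. No derivative is taken:
  the gain from any deviation factors exactly, so its sign can be read off.\<close>

lemma contest_best_response_iff:
  fixes A x c v :: real
  assumes "A > 0" "x \<ge> 0" "c > 0" "v > 0"
  shows "(\<forall>t\<ge>0. v * (t / (A + t)) - c * t \<le> v * (x / (A + x)) - c * x) \<longleftrightarrow>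
         v * A \<le> c * (A + x)\<^sup>2 \<and> (x > 0 \<longrightarrow> v * A = c * (A + x)\<^sup>2)"
    (is "?L \<longleftrightarrow> ?R")
proof -
  \<comment> \<open>Chosen so that the gain from bidding \<open>t\<close> instead of
    \<open>x\<close> is a positive multiple of \<open>(t - x) * (K - (A + t))\<close>.\<close>
  define K where "K = v * A / (c * (A + x))"
  have pos: "A + x > 0" using assms by simp
  have K_le: "K \<le> A + x \<longleftrightarrow> v * A \<le> c * (A + x)\<^sup>2"
    and K_eq: "K = A + x \<longleftrightarrow> v * A = c * (A + x)\<^sup>2"
    using pos assms by (simp_all add: K_def divide_le_eq divide_eq_eq power2_eq_square mult_ac)
  have diff: "v * (t / (A + t)) - c * t - (v * (x / (A + x)) - c * x)
      = c / (A + t) * ((t - x) * (K - (A + t)))" if "t \<ge> 0" for t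
  proof -
    have "A + t > 0" using that assms by simp
    have "v * (t / (A + t)) - v * (x / (A + x)) = v * A * (t - x) / ((A + t) * (A + x))"
      using \<open>A + t > 0\<close> pos by (simp add: divide_simps) (simp add: algebra_simps)
    moreover have "c / (A + t) * ((t - x) * K) = v * A * (t - x) / ((A + t) * (A + x))"
      using \<open>A + t > 0\<close> pos assms by (simp add: K_def divide_simps)
    moreover have "c / (A + t) * ((t - x) * (A + t)) = c * (t - x)"
      using \<open>A + t > 0\<close> by simp
    ultimately show ?thesis by (simp add: algebra_simps)
  qed
  have sign: "v * (t / (A + t)) - c * t \<le> v * (x / (A + x)) - c * x \<longleftrightarrow>
      (t - x) * (K - (A + t)) \<le> 0" if "t \<ge> 0" for t
  proof -
    have "c / (A + t) > 0" using that assms by simp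
    then have "c / (A + t) * ((t - x) * (K - (A + t))) \<le> 0 \<longleftrightarrow> (t - x) * (K - (A + t)) \<le> 0"
      by (simp only: mult_le_0_iff) linarith
    then show ?thesis using diff[OF that] by linarith
  qed
  have "?L \<longleftrightarrow> (\<forall>t\<ge>0. (t - x) * (K - (A + t)) \<le> 0)"
    using sign by blast
  also have "\<dots> \<longleftrightarrow> K \<le> A + x \<and> (x > 0 \<longrightarrow> K = A + x)"
  proof (intro iffI conjI impI)
    assume *: "\<forall>t\<ge>0. (t - x) * (K - (A + t)) \<le> 0"
    \<comment> \<open>Letting \<open>t\<close> tend to \<open>x\<close> from above gives
      \<open>K \<le> A + x\<close>. Approaching from below gives the reverse inequality, but is
      possible only for \<open>x > 0\<close>.\<close>
    have "K - A \<le> t" if "t > x" for t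
      using *[rule_format, of t] that assms(2) by (auto simp: mult_le_0_iff)
    then show le: "K \<le> A + x" using dense_ge[of x "K - A"] by force
    assume "x > 0"
    have "t \<le> K - A" if "0 < t" "t < x" for t
      using *[rule_format, of t] that by (auto simp: mult_le_0_iff)
    then show "K = A + x" using dense_le_bounded[of 0 x "K - A"] \<open>x > 0\<close> le by force
  next
    assume K: "K \<le> A + x \<and> (x > 0 \<longrightarrow> K = A + x)"
    show "\<forall>t\<ge>0. (t - x) * (K - (A + t)) \<le> 0"
      using K assms(2) by (auto simp: mult_le_0_iff)
  qed
  finally show ?thesis using K_le K_eq by simp
qed

text \<open>With total \<open>T\<close> the rivals of \<open>i\<close> bid \<open>T - x i\<close>,
  and the first-order condition says that \<open>x i\<close> is the larger of 0 and
  \<open>T * (1 - c i * T / v)\<close>. This requires a positive bid total of the rivals, so in both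
  directions \<open>x i < T\<close> is established first.\<close>

lemma contest_equilibrium_iff:
  assumes fin: "finite R" and card: "card R \<ge> 2"
    and c: "\<forall>i\<in>R. c i > 0" and v: "v > 0"
  shows "contest_equilibrium R c v x \<longleftrightarrow>
    sum x R > 0 \<and> (\<forall>i\<in>R. x i = sum x R * max 0 (1 - c i * sum x R / v))"
    (is "?L \<longleftrightarrow> ?R")
proof -
  define T where "T = sum x R"
  have upd: "contest_payoff R c v i (x(i := t)) = v * (t / (T - x i + t)) - c i * t"
    if "i \<in> R" for i t
    using that fin
    by (simp add: contest_payoff_def sum_fun_upd T_def del: fun_upd_apply) simp
  have own: "contest_payoff R c v i x = v * (x i / T) - c i * x i" for i
    by (simp add: contest_payoff_def T_def)
  have response: "(\<forall>t\<ge>0. contest_payoff R c v i (x(i := t)) \<le> contest_payoff R c v i x) \<longleftrightarrow>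
      x i = T * max 0 (1 - c i * T / v)"
    if i: "i \<in> R" and "x i \<ge> 0" "x i < T" for i
  proof -
    have "T > 0" using that by simp
    have "(\<forall>t\<ge>0. contest_payoff R c v i (x(i := t)) \<le> contest_payoff R c v i x) \<longleftrightarrow>
        v * (T - x i) \<le> c i * T\<^sup>2 \<and> (x i > 0 \<longrightarrow> v * (T - x i) = c i * T\<^sup>2)"
      using contest_best_response_iff[of "T - x i" "x i" "c i" v] that c[rule_format, OF i] v
      by (simp add: upd own)
    also have "v * (T - x i) \<le> c i * T\<^sup>2 \<longleftrightarrow> T * (1 - c i * T / v) \<le> x i"
      using v by (simp add: field_simps power2_eq_square)
    also have "v * (T - x i) = c i * T\<^sup>2 \<longleftrightarrow> x i = T * (1 - c i * T / v)"
      using v by (auto simp: field_simps power2_eq_square)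
    also have "T * (1 - c i * T / v) \<le> x i \<and> (x i > 0 \<longrightarrow> x i = T * (1 - c i * T / v)) \<longleftrightarrow>
        x i = max 0 (T * (1 - c i * T / v))"
      using \<open>x i \<ge> 0\<close> by linarith
    also have "max 0 (T * (1 - c i * T / v)) = T * max 0 (1 - c i * T / v)"
      using \<open>T > 0\<close> by (simp add: max_mult_distrib_left)
    finally show ?thesis .
  qed
  show ?thesis
  proof
    assume L: ?L
    have nonneg: "x i \<ge> 0" if "i \<in> R" for i
      using L that by (simp add: contest_equilibrium_def)
    have dev: "v * (t / (T - x i + t)) - c i * t \<le> v * (x i / T) - c i * x i"
      if "i \<in> R" "t \<ge> 0" for i t
      using L that by (auto simp: contest_equilibrium_def upd own)
    have "T \<ge> 0" unfolding T_def using nonneg by (rule sum_nonneg)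
    have "T \<noteq> 0"
    proof
      assume "T = 0"
      then have zero: "x i = 0" if "i \<in> R" for i
        using that fin nonneg by (simp add: T_def sum_nonneg_eq_0_iff)
      \<comment> \<open>If nobody bids, any positive bid wins the whole prize;
        \<open>v / (2 * c i)\<close> costs only half of it.\<close>
      obtain i where i: "i \<in> R" using card by fastforce
      show False
        using dev[OF i, of "v / (2 * c i)"] \<open>T = 0\<close> zero[OF i] c[rule_format, OF i] v by simp
    qed
    with \<open>T \<ge> 0\<close> have "T > 0" by simp
    \<comment> \<open>A sole bidder would keep the whole prize after halving its bid, at lower
      cost.\<close>
    have "x i < T" if i: "i \<in> R" for i
    proof (rule ccontr)
      assume "\<not> x i < T"
      moreover have "x i \<le> T" unfolding T_def using fin i nonneg by (intro member_le_sum) auto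
      ultimately have "x i = T" by simp
      then show False using dev[OF i, of "T / 2"] \<open>T > 0\<close> c[rule_format, OF i] v by simp
    qed
    then show ?R
      using \<open>T > 0\<close> L response nonneg unfolding contest_equilibrium_def T_def by blast
  next
    assume R: ?R
    then have "T > 0" and eq: "\<And>i. i \<in> R \<Longrightarrow> x i = T * max 0 (1 - c i * T / v)"
      unfolding T_def by blast+
    have "x i \<ge> 0 \<and> x i < T" if i: "i \<in> R" for i
    proof -
      \<comment> \<open>The factor is strictly below 1, so no player bids the whole total.\<close>
      have "0 \<le> max 0 (1 - c i * T / v)" "max 0 (1 - c i * T / v) < 1"
        using \<open>T > 0\<close> c[rule_format, OF i] v by auto
      then show ?thesis
        using eq[OF i] \<open>T > 0\<close> mult_strict_left_mono[of _ 1 T] by fastforce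
    qed
    then show ?L
      using response eq unfolding contest_equilibrium_def by blast
  qed
qed

section \<open>Existence and uniqueness of the contest equilibrium\<close>

text \<open>The sum falls continuously from \<open>card R\<close> at 0 to 0 at a large total, so it
  takes the value 1. It is constant once it has reached 0, so strict decrease is proved only from a
  point where it equals 1, which suffices for uniqueness.\<close>

lemma ex1_contest_total:
  fixes c :: "'r \<Rightarrow> real" and v :: real
  assumes fin: "finite R" and card: "card R \<ge> 2"
    and c: "\<forall>i\<in>R. c i > 0" and v: "v > 0"
  shows "\<exists>!T. T > 0 \<and> (\<Sum>i\<in>R. max 0 (1 - c i * T / v)) = 1"
proof -
  define g where "g = (\<lambda>T. \<Sum>i\<in>R. max 0 (1 - c i * T / v))"
  have strict: "g b < 1" if "0 < a" "a < b" "g a = 1" for a b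
  proof -
    have less: "c i * a / v < c i * b / v" if "i \<in> R" for i
      using c[rule_format, OF that] v \<open>a < b\<close> by (simp add: divide_strict_right_mono)
    \<comment> \<open>A sum equal to 1 has a positive term; that term drops strictly while no other
      term grows.\<close>
    have "\<exists>i\<in>R. max 0 (1 - c i * a / v) > 0"
    proof (rule ccontr)
      assume "\<not> (\<exists>i\<in>R. max 0 (1 - c i * a / v) > 0)"
      then have "g a = 0" unfolding g_def by (intro sum.neutral) force
      with \<open>g a = 1\<close> show False by simp
    qed
    then obtain i where i: "i \<in> R" "max 0 (1 - c i * a / v) > 0" by blast
    have "g b < g a"
      unfolding g_def
    proof (rule sum_strict_mono_ex1[OF fin])
      show "\<forall>i\<in>R. max 0 (1 - c i * b / v) \<le> max 0 (1 - c i * a / v)"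
        using less by fastforce
      show "\<exists>i\<in>R. max 0 (1 - c i * b / v) < max 0 (1 - c i * a / v)"
        using i less[OF i(1)] by (intro bexI[of _ i]) auto
    qed
    with \<open>g a = 1\<close> show ?thesis by simp
  qed
  \<comment> \<open>The term of player \<open>i\<close> vanishes from \<open>v / c i\<close>
    onwards, and \<open>B\<close> is at least each of these values.\<close>
  define B where "B = (\<Sum>i\<in>R. v / c i)"
  have "B \<ge> 0" unfolding B_def using c v by (simp add: sum_nonneg less_imp_le)
  have "max 0 (1 - c i * B / v) = 0" if i: "i \<in> R" for i
  proof -
    have "v / c i \<le> B"
      unfolding B_def using fin i c v by (intro member_le_sum) (auto simp: less_imp_le)
    then have "1 \<le> c i * B / v" using c[rule_format, OF i] v by (simp add: field_simps)
    then show ?thesis by simp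
  qed
  then have gB: "g B = 0" by (simp add: g_def)
  have g0: "g 0 = real (card R)" by (simp add: g_def)
  have "\<exists>T\<ge>0. T \<le> B \<and> g T = 1"
  proof (rule IVT2')
    show "continuous_on {0..B} g" unfolding g_def using v by (intro continuous_intros) auto
  qed (use gB g0 card \<open>B \<ge> 0\<close> in auto)
  then obtain T where T: "T \<ge> 0" "g T = 1" by blast
  moreover have "T \<noteq> 0" using T(2) g0 card by auto
  ultimately have "T > 0 \<and> g T = 1" by simp
  moreover have "T' = T''" if "T' > 0 \<and> g T' = 1" "T'' > 0 \<and> g T'' = 1" for T' T''
    using strict[of T' T''] strict[of T'' T'] that by (cases T' T'' rule: linorder_cases) auto
  ultimately show ?thesis unfolding g_def by blast
qed

text \<open>Summing the bid formula and cancelling the positive total makes every equilibrium total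
  a root of the same equation. Equal totals give equal bids, but only on \<open>R\<close>, since
  \<open>contest_equilibrium\<close> does not constrain values elsewhere.\<close>

lemma contest_equilibrium_unique:
  assumes fin: "finite R" and card: "card R \<ge> 2"
    and c: "\<forall>i\<in>R. c i > 0" and v: "v > 0"
    and eq: "contest_equilibrium R c v x" "contest_equilibrium R c v y" and i: "i \<in> R"
  shows "x i = y i"
proof -
  note iff = contest_equilibrium_iff[OF fin card c v]
  have total: "(\<Sum>i\<in>R. max 0 (1 - c i * sum z R / v)) = 1" if "contest_equilibrium R c v z" for z
  proof -
    have "sum z R > 0" using that iff by blast
    have "sum z R = (\<Sum>i\<in>R. sum z R * max 0 (1 - c i * sum z R / v))"
      using that iff by (intro sum.cong) blast+
    then have "sum z R * (\<Sum>i\<in>R. max 0 (1 - c i * sum z R / v)) = sum z R * 1"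
      by (simp add: sum_distrib_left)
    with \<open>sum z R > 0\<close> show ?thesis by simp
  qed
  have "sum x R = sum y R"
    using ex1_contest_total[OF fin card c v] total eq iff by blast
  then show ?thesis using iff eq i by metis
qed

lemma contest_equilibrium_exists:
  assumes fin: "finite R" and card: "card R \<ge> 2"
    and c: "\<forall>i\<in>R. c i > 0" and v: "v > 0"
  shows "\<exists>x. contest_equilibrium R c v x"
proof -
  obtain T where T: "T > 0" "(\<Sum>i\<in>R. max 0 (1 - c i * T / v)) = 1"
    using ex1_contest_total[OF fin card c v] by blast
  define x where "x = (\<lambda>i. T * max 0 (1 - c i * T / v))"
  \<comment> \<open>The root equation is the consistency condition that bids computed from
    \<open>T\<close> add up to \<open>T\<close>.\<close>
  have "sum x R = T" using T(2) by (simp add: x_def sum_distrib_left[symmetric])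
  then have "contest_equilibrium R c v x"
    using T(1) by (simp add: contest_equilibrium_iff[OF fin card c v]) (simp add: x_def)
  then show ?thesis by blast
qed

section \<open>Closed form of the bids and shape of the active set\<close>

lemma contest_equilibrium_explicit:
  assumes fin: "finite R" and card: "card R \<ge> 2"
    and c: "\<forall>i\<in>R. c i > 0" and v: "v > 0"
    and eq: "contest_equilibrium R c v x"
  defines "S \<equiv> {i \<in> R. x i > 0}"
  defines "m \<equiv> real (card S) - 1" and "E \<equiv> sum c S"
  shows "card S \<ge> 2"
    and "S = {i \<in> R. c i < E / m}"
    and "i \<in> R \<Longrightarrow> x i = (if i \<in> S then m * v / E * (1 - m * c i / E) else 0)"
proof -
  define T where "T = sum x R"
  have T: "T > 0" and x: "\<And>i. i \<in> R \<Longrightarrow> x i = T * max 0 (1 - c i * T / v)"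
    using eq unfolding contest_equilibrium_iff[OF fin card c v] T_def by blast+
  have "S \<subseteq> R" "finite S" using fin by (auto simp: S_def)
  have zero: "x i = 0" if "i \<in> R - S" for i
  proof -
    have "0 \<le> x i" using that x T by simp
    then show ?thesis using that by (simp add: S_def)
  qed
  then have "T = sum x S"
    unfolding T_def using fin \<open>S \<subseteq> R\<close> by (intro sum.mono_neutral_right) auto
  then have "S \<noteq> {}" using T by auto
  then have "E > 0" unfolding E_def using c \<open>finite S\<close> \<open>S \<subseteq> R\<close> by (intro sum_pos) auto
  have xS: "x i = T * (1 - c i * T / v)" if "i \<in> S" for i
    using that x[of i] by (auto simp: S_def max_def split: if_splits)
  have "T = (\<Sum>i\<in>S. T * (1 - c i * T / v))"
    using \<open>T = sum x S\<close> xS by simp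
  also have "\<dots> = T * (real (card S) - E * T / v)"
    by (simp add: sum_distrib_left[symmetric] sum_subtractf E_def
        sum_distrib_right sum_divide_distrib)
  finally have ET: "E * T / v = m" using T by (simp add: m_def)
  \<comment> \<open>\<open>m\<close> equals the positive quantity \<open>E * T / v\<close>, which
    forces at least two active players.\<close>
  then have "m > 0" using \<open>E > 0\<close> T v by auto
  then show "card S \<ge> 2" by (simp add: m_def)
  have T_eq: "T = m * v / E" using ET v \<open>E > 0\<close> by (auto simp: field_simps)
  have ratio: "c i * T / v = m * c i / E" for i using v by (simp add: T_eq)
  have "x i > 0 \<longleftrightarrow> c i < E / m" if "i \<in> R" for i
  proof -
    have "x i > 0 \<longleftrightarrow> m * c i / E < 1"
      using x[OF that] T by (auto simp: ratio zero_less_mult_iff less_max_iff_disj)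
    also have "\<dots> \<longleftrightarrow> c i < E / m" using \<open>m > 0\<close> \<open>E > 0\<close> by (simp add: field_simps)
    finally show ?thesis .
  qed
  then show "S = {i \<in> R. c i < E / m}" by (auto simp: S_def)
  show "x i = (if i \<in> S then m * v / E * (1 - m * c i / E) else 0)" if "i \<in> R"
  proof (cases "i \<in> S")
    case True
    then show ?thesis using xS[OF True] by (simp only: ratio if_True) (simp add: T_eq)
  qed (use zero that in simp)
qed

text \<open>Along a sorted enumeration the indices below the threshold form a down-closed set, hence
  an initial segment; injectivity of \<open>\<sigma>\<close> identifies its length as
  \<open>card S\<close>. Players of equal cost are all in or all out, so the order among ties is
  irrelevant.\<close>

lemma sorted_sublevel_eq_prefix:
  fixes c :: "'r \<Rightarrow> 'b::linorder" and \<theta> :: 'b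
  assumes bij: "bij_betw \<sigma> {1..n} R"
    and sorted: "\<forall>j\<in>{1..<n}. c (\<sigma> j) \<le> c (\<sigma> (j + 1))"
  defines "S \<equiv> {i \<in> R. c i < \<theta>}"
  shows "S = \<sigma> ` {1..card S}"
proof -
  define J where "J = {j \<in> {1..n}. c (\<sigma> j) < \<theta>}"
  have mono: "c (\<sigma> j) \<le> c (\<sigma> k)" if "j \<le> k" "1 \<le> j" "k \<le> n" for j k
    using that
  proof (induction k rule: dec_induct)
    case (step k)
    then have "c (\<sigma> k) \<le> c (\<sigma> (k + 1))" using sorted by simp
    with step show ?case by simp
  qed simp
  have S: "S = \<sigma> ` J"
    using bij by (auto simp: S_def J_def bij_betw_def)
  have "J = {1..card J}"
  proof (cases "J = {}")
    case False
    have "finite J" by (simp add: J_def)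
    have "Max J \<in> J" using False \<open>finite J\<close> by simp
    \<comment> \<open>A down-closed set of indices is determined by its maximum.\<close>
    have "J = {1..Max J}"
    proof
      show "J \<subseteq> {1..Max J}" using \<open>finite J\<close> by (auto simp: J_def)
      show "{1..Max J} \<subseteq> J"
      proof
        fix j assume j: "j \<in> {1..Max J}"
        then have "c (\<sigma> j) \<le> c (\<sigma> (Max J))"
          using \<open>Max J \<in> J\<close> by (intro mono) (auto simp: J_def)
        with j \<open>Max J \<in> J\<close> show "j \<in> J" by (auto simp: J_def)
      qed
    qed
    then show ?thesis by (metis card_atLeastAtMost diff_Suc_1)
  qed simp
  moreover have "card S = card J"
    unfolding S using bij
    by (intro card_image) (auto simp: bij_betw_def J_def intro: inj_on_subset)
  ultimately show ?thesis using S by metis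
qed

section \<open>Decomposition of the followers' game into contests\<close>

lemma follower_payoff_eq_sum_contest_payoff:
  "follower_payoff F R e C i r = (\<Sum>f\<in>F. contest_payoff R (\<lambda>i. e i f) (C f) i (\<lambda>j. r j f))"
proof -
  have "follower_share R r i f = r i f / (\<Sum>j\<in>R. r j f)" for f
    by (simp add: follower_share_def sum.neutral)
  then show ?thesis by (simp add: follower_payoff_def contest_payoff_def)
qed

text \<open>A deviation in one flow leaves the payoff from all other flows unchanged, so an
  equilibrium of the game is one in each flow. Conversely, the flow-wise inequalities add up to the
  inequality for an arbitrary deviation.\<close>

lemma followers_equilibrium_iff:
  assumes finF: "finite F"
  shows "followers_equilibrium F R e C r \<longleftrightarrow>
    r \<in> R \<rightarrow>\<^sub>E (F \<rightarrow>\<^sub>E {0..}) \<and>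
    (\<forall>f\<in>F. contest_equilibrium R (\<lambda>i. e i f) (C f) (\<lambda>j. r j f))"
    (is "?L \<longleftrightarrow> ?P \<and> ?R")
proof -
  let ?V = "\<lambda>f i x. contest_payoff R (\<lambda>i. e i f) (C f) i x"
  have payoff: "follower_payoff F R e C i r' = (\<Sum>f\<in>F. ?V f i (\<lambda>j. r' j f))" for i r'
    by (rule follower_payoff_eq_sum_contest_payoff)
  \<comment> \<open>Seen from flow \<open>f\<close>, a change of the whole strategy of
    \<open>i\<close> is a change of a single bid.\<close>
  have column: "(\<lambda>j. (r(i := s)) j f) = (\<lambda>j. r j f)(i := s f)" for i s f
    by auto
  have L_iff: "?L \<longleftrightarrow> ?P \<and> (\<forall>i\<in>R. \<forall>s\<in>F \<rightarrow>\<^sub>E {0..}.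
      (\<Sum>f\<in>F. ?V f i ((\<lambda>j. r j f)(i := s f))) \<le> (\<Sum>f\<in>F. ?V f i (\<lambda>j. r j f)))"
    by (simp only: followers_equilibrium_def nash_equilibrium_def follower_strategies_def
        payoff column)
  show ?thesis
  proof
    assume L: ?L
    then have P: ?P using L_iff by blast
    have "?V f i ((\<lambda>j. r j f)(i := t)) \<le> ?V f i (\<lambda>j. r j f)"
      if f: "f \<in> F" and i: "i \<in> R" and "t \<ge> 0" for f i t
    proof -
      \<comment> \<open>Deviates in flow \<open>f\<close> only, so the summands of the other flows
        cancel.\<close>
      define s where "s = (r i)(f := t)"
      have "s \<in> F \<rightarrow>\<^sub>E {0..}"
        using P f i \<open>t \<ge> 0\<close> by (auto simp: s_def PiE_iff extensional_def)
      then have "(\<Sum>g\<in>F. ?V g i ((\<lambda>j. r j g)(i := s g))) \<le> (\<Sum>g\<in>F. ?V g i (\<lambda>j. r j g))"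
        using L L_iff i by blast
      moreover have "(\<Sum>g\<in>F - {f}. ?V g i ((\<lambda>j. r j g)(i := s g)))
          = (\<Sum>g\<in>F - {f}. ?V g i (\<lambda>j. r j g))"
        by (rule sum.cong) (auto simp: s_def fun_upd_idem)
      ultimately show ?thesis
        using finF f by (simp add: sum.remove[of F f] s_def)
    qed
    moreover have "0 \<le> r i f" if "i \<in> R" "f \<in> F" for i f
      using P that by (auto simp: PiE_iff)
    ultimately show "?P \<and> ?R" using P by (simp add: contest_equilibrium_def)
  next
    assume "?P \<and> ?R"
    then show ?L
      unfolding L_iff by (auto simp: contest_equilibrium_def PiE_iff intro!: sum_mono)
  qed
qed

section \<open>Transfer of the contest results to all flows\<close>

theorem theorem2:
  fixes F :: "'f set" and R :: "'r set"
    and e :: "'r \<Rightarrow> 'f \<Rightarrow> real" and C :: "'f \<Rightarrow> real"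
  assumes "finite F" and "finite R" and "card R \<ge> 2"
    and "\<And>i f. i \<in> R \<Longrightarrow> f \<in> F \<Longrightarrow> e i f > 0"
    and "\<And>f. f \<in> F \<Longrightarrow> C f > 0"
  shows "(\<forall>r. followers_equilibrium F R e C r \<longrightarrow>
            (\<forall>f\<in>F. let S = active_aps R r f; m = real (card S) - 1; E = (\<Sum>j\<in>S. e j f) in
               (\<forall>i\<in>R. r i f = (if i \<in> S then m * C f / E * (1 - m * e i f / E) else 0)) \<and>
               (\<forall>\<sigma> :: nat \<Rightarrow> 'r.
                  bij_betw \<sigma> {1..card R} R \<and>
                  (\<forall>j\<in>{1..<card R}. e (\<sigma> j) f \<le> e (\<sigma> (j + 1)) f) \<longrightarrow>
                  (\<exists>i\<in>{2..card R}. S = \<sigma> ` {1..i} \<and>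
                     (i < card R \<longrightarrow>
                        e (\<sigma> (i + 1)) f \<ge> (\<Sum>j = 1..i. e (\<sigma> j) f) / (real i - 1)))))) \<and>
         (\<exists>!r. followers_equilibrium F R e C r)"
proof (intro conjI allI impI ballI)
  note equilibrium_iff = followers_equilibrium_iff[OF assms(1), of R e C]
  have pos: "\<forall>i\<in>R. e i f > 0" if "f \<in> F" for f
    using assms(4) that by blast
  {
    fix r f
    assume r: "followers_equilibrium F R e C r" and f: "f \<in> F"
    define S m E where "S = active_aps R r f" and "m = real (card S) - 1" and "E = (\<Sum>j\<in>S. e j f)"
    have S: "S = {i \<in> R. r i f > 0}" by (simp add: S_def active_aps_def)
    have "contest_equilibrium R (\<lambda>i. e i f) (C f) (\<lambda>j. r j f)"
      using r f equilibrium_iff by blast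
    from contest_equilibrium_explicit[OF assms(2,3) pos[OF f] assms(5)[OF f] this]
    have card_S: "card S \<ge> 2" and S_eq: "S = {i \<in> R. e i f < E / m}"
      and r_eq: "\<forall>i\<in>R. r i f = (if i \<in> S then m * C f / E * (1 - m * e i f / E) else 0)"
      by (simp_all add: S[symmetric] m_def E_def)
    have prefix: "\<exists>i\<in>{2..card R}. S = \<sigma> ` {1..i} \<and>
        (i < card R \<longrightarrow> e (\<sigma> (i + 1)) f \<ge> (\<Sum>j = 1..i. e (\<sigma> j) f) / (real i - 1))"
      if bij: "bij_betw \<sigma> {1..card R} R"
        and sorted: "\<forall>j\<in>{1..<card R}. e (\<sigma> j) f \<le> e (\<sigma> (j + 1)) f" for \<sigma>
    proof (intro bexI conjI impI)
      \<comment> \<open>The prefix length is \<open>card S\<close>.\<close>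
      show "card S \<in> {2..card R}"
        using card_S card_mono[OF \<open>finite R\<close>, of S] by (auto simp: S)
      then have sub: "{1..card S} \<subseteq> {1..card R}" by auto
      show img: "S = \<sigma> ` {1..card S}"
        using sorted_sublevel_eq_prefix[OF bij, of "\<lambda>i. e i f" "E / m"] sorted
        by (simp add: S_eq[symmetric])
      have inj: "inj_on \<sigma> {1..card R}" using bij by (simp add: bij_betw_def)
      have "E = (\<Sum>j\<in>\<sigma> ` {1..card S}. e j f)"
        using img by (simp add: E_def)
      also have "\<dots> = (\<Sum>j = 1..card S. e (\<sigma> j) f)"
        using inj_on_subset[OF inj sub] by (simp add: sum.reindex)
      finally have E: "E = (\<Sum>j = 1..card S. e (\<sigma> j) f)" .
      assume less: "card S < card R"
      \<comment> \<open>By injectivity the next AP in the order lies outside the prefix, hence is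
        inactive, so its cost is not below the threshold \<open>E / m\<close>.\<close>
      then have "\<sigma> (card S + 1) \<notin> \<sigma> ` {1..card S}"
        using inj_on_image_mem_iff[OF inj, of "card S + 1" "{1..card S}"] sub by simp
      moreover have "\<sigma> (card S + 1) \<in> R"
        using bij_betwE[OF bij] less by simp
      ultimately have "\<not> e (\<sigma> (card S + 1)) f < E / m" using img S_eq by blast
      then show "e (\<sigma> (card S + 1)) f \<ge> (\<Sum>j = 1..card S. e (\<sigma> j) f) / (real (card S) - 1)"
        unfolding E m_def by simp
    qed
    show "let S = active_aps R r f; m = real (card S) - 1; E = (\<Sum>j\<in>S. e j f) in
        (\<forall>i\<in>R. r i f = (if i \<in> S then m * C f / E * (1 - m * e i f / E) else 0)) \<and>
        (\<forall>\<sigma> :: nat \<Rightarrow> 'r.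
           bij_betw \<sigma> {1..card R} R \<and>
           (\<forall>j\<in>{1..<card R}. e (\<sigma> j) f \<le> e (\<sigma> (j + 1)) f) \<longrightarrow>
           (\<exists>i\<in>{2..card R}. S = \<sigma> ` {1..i} \<and>
              (i < card R \<longrightarrow> e (\<sigma> (i + 1)) f \<ge> (\<Sum>j = 1..i. e (\<sigma> j) f) / (real i - 1))))"
      unfolding Let_def S_def[symmetric] m_def[symmetric] E_def[symmetric]
      using r_eq prefix by blast
  }
  show "\<exists>!r. followers_equilibrium F R e C r"
  proof (rule ex_ex1I)
    have "\<forall>f\<in>F. \<exists>x. contest_equilibrium R (\<lambda>i. e i f) (C f) x"
      using contest_equilibrium_exists[OF assms(2,3) pos assms(5)] by blast
    then obtain x where x: "\<And>f. f \<in> F \<Longrightarrow> contest_equilibrium R (\<lambda>i. e i f) (C f) (x f)"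
      by metis
    \<comment> \<open>Restriction to \<open>R\<close> and \<open>F\<close> makes the profile and its
      strategies extensional, as the strategy sets demand.\<close>
    define r where "r = (\<lambda>i\<in>R. \<lambda>f\<in>F. x f i)"
    have "contest_equilibrium R (\<lambda>i. e i f) (C f) (\<lambda>j. r j f)" if f: "f \<in> F" for f
    proof -
      \<comment> \<open>The column of \<open>r\<close> may differ from \<open>x f\<close> outside
        \<open>R\<close>, but the characterization of contest equilibria reads only bids in
        \<open>R\<close>.\<close>
      have "\<forall>j\<in>R. r j f = x f j" using f by (simp add: r_def)
      then have "sum (\<lambda>j. r j f) R = sum (x f) R" by (intro sum.cong) auto
      then show ?thesis
        using x[OF f] \<open>\<forall>j\<in>R. r j f = x f j\<close>
        unfolding contest_equilibrium_iff[OF assms(2,3) pos[OF f] assms(5)[OF f]] by metis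
    qed
    moreover have "r \<in> R \<rightarrow>\<^sub>E (F \<rightarrow>\<^sub>E {0..})"
      using x by (auto simp: r_def contest_equilibrium_def)
    ultimately show "\<exists>r. followers_equilibrium F R e C r"
      using equilibrium_iff by blast
  next
    fix r s
    assume "followers_equilibrium F R e C r" "followers_equilibrium F R e C s"
    then have r: "r \<in> R \<rightarrow>\<^sub>E (F \<rightarrow>\<^sub>E {0..})" and s: "s \<in> R \<rightarrow>\<^sub>E (F \<rightarrow>\<^sub>E {0..})"
      and eq: "\<And>f. f \<in> F \<Longrightarrow> contest_equilibrium R (\<lambda>i. e i f) (C f) (\<lambda>j. r j f)"
        "\<And>f. f \<in> F \<Longrightarrow> contest_equilibrium R (\<lambda>i. e i f) (C f) (\<lambda>j. s j f)"
      using equilibrium_iff by blast+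
    have "r i f = s i f" if "i \<in> R" "f \<in> F" for i f
      using contest_equilibrium_unique[OF assms(2,3) pos[OF that(2)] assms(5)[OF that(2)]
          eq(1)[OF that(2)] eq(2)[OF that(2)] that(1)] .
    \<comment> \<open>Agreement on all players and flows becomes equality by extensionality, applied
      first to strategies and then to profiles.\<close>
    then have "r i = s i" if "i \<in> R" for i
      using that r s by (intro PiE_ext[of "r i" F "\<lambda>_. {0..}" "s i"]) (auto dest: PiE_mem)
    then show "r = s" using r s by (intro PiE_ext[OF r s])
  qed
qed

end
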